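(* Let $n\ge 1$ and $i\ge 0$ be integers (and, in item (3), let $0\le k\le n$). Let $g=(g_0,g_1,\dots,g_{\lfloor d/2\rfloor})$ denote the $g$-vector of the relevant palindromic polynomial of palindromic degree $d$. Then: (1) If $g$ is the $g$-vector of $[n]!=\prod_{m=1}^n(1+q+\cdots+q^{m-1})$, then, with $d=\binom{n}{2}$, $$g_i=\sum_{j\ge 0}(-1)^j\,\bigl|\mathcal{T}(n,j)\times\mathcal{B}_d(i,j)\bigr|.$$ (2) If $g$ is the $g$-vector of $\prod_{m=1}^n(1+q^m)$, then, with $d=\binom{n+1}{2}$, $$g_i=\sum_{j\ge 0}(-1)^j\,\bigl|\mathcal{T}'(n,j)\times\mathcal{B}_d(i,j)\bigr|.$$ (3) If $g$ is the $g$-vector of the $q$-binomial coefficient $\left[{n\atop k}\right]_q=\frac{[n]!}{[k]!\,[n-k]!}$, then, with $d=k(n-k)$, $$g_i=\sum_{j\ge 0}(-1)^j\,\bigl|\mathcal{L}(n,k,j)\times\mathcal{B}_d(i,j)\bigr|.$$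
   Context: A polynomial $h(q)=\sum h_iq^i$ with integer coefficients is palindromic of palindromic degree $d$ if $q^dh(1/q)=h(q)$. Such an $h$ can be written uniquely as $h(q)=\sum_{0\le 2i\le d} g_i(q^i+q^{i+1}+\cdots+q^{d-i})$; the vector $(g_0,\dots,g_{\lfloor d/2\rfloor})$ is the $g$-vector of $h$ (equivalently $g_i=h_i-h_{i-1}$ for $i\le d/2$). Write $[m]=1+q+\cdots+q^{m-1}$ and $[m]!=[m][m-1]\cdots[1]$. Ballot paths: $\mathcal{B}_d(i,j)$ is the set of words in the letters $E,N$ of length $d-2j$ containing exactly $i-j$ letters $N$, such that every initial segment contains at least as many $E$'s as $N$'s (empty if $j>i$). Path matchings: $T(m,j)$ is the set of matchings (sets of pairwise disjoint edges) with exactly $j$ edges in the path graph on $m$ vertices (so $|T(m,j)|=\binom{m-j}{j}$). $\mathcal{T}(n,j)=\bigcup_{j_1+\cdots+j_{n-1}=j}T(1,j_1)\times T(2,j_2)\times\cdots\times T(n-1,j_{n-1})$, i.e. $(n-1)$-tuples of matchings of paths with $1,2,\dots,n-1$ vertices having $j$ edges in total. Cycle matchings: $T'(m,j)$ is the set of matchings with $j$ edges of the $m$-cycle graph (the cycle with $m$ vertices and $m$ edges; for $m=1$ a single vertex with a loop, which cannot be used in a matching; for $m=2$ two vertices joined by two parallel edges), so $|T'(m,j)|=\frac{m}{m-j}\binom{m-j}{j}$. $\mathcal{T}'(n,j)=\bigcup_{j_1+\cdots+j_n=j}T'(1,j_1)\times\cdots\times T'(n,j_n)$. Lucanomial matchings: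 a partition $\lambda=(\lambda_1\ge\cdots\ge\lambda_k\ge 0)$ fits in a $k\times(n-k)$ rectangle if $\lambda_1\le n-k$. Its complement is $\lambda^*=(\lambda^*_1,\dots,\lambda^*_{n-k})$ with $\lambda^*_r=k-\#\{s:\lambda_s\ge n-k+1-r\}$. A matching of a path is strict if its first vertex is not isolated (the empty path has exactly one strict matching, the empty one; the one-vertex path has none). $\mathcal{L}(n,k,j)$ is the set of all pairs $(\lambda,(M_1,\dots,M_k,M'_1,\dots,M'_{n-k}))$ with $\lambda$ fitting in the $k\times(n-k)$ rectangle, $M_r$ a matching of the path with $\lambda_r$ vertices, $M'_r$ a strict matching of the path with $\lambda^*_r$ vertices, and the total number of edges equal to $j$. *)

theory Defs
  imports
    Complex_Main
    "HOL-Library.Disjoint_Sets"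
    "HOL-Computational_Algebra.Polynomial"
begin

section \<open>Palindromic polynomials and their g-vectors\<close>

text \<open>\<open>q\<^sup>d h(1/q) = h(q)\<close> is an identity of rational functions; over an infinite field it may be
  tested at all nonzero points. The lemma \<open>palindromic_iff_coeff\<close> below gives the coefficient form.\<close>

definition palindromic :: "nat \<Rightarrow> int poly \<Rightarrow> bool" where
  "palindromic d h \<longleftrightarrow>
     (\<forall>x::rat. x \<noteq> 0 \<longrightarrow> x ^ d * poly (map_poly of_int h) (1 / x) = poly (map_poly of_int h) x)"

definition g_expansion :: "nat \<Rightarrow> (nat \<Rightarrow> int) \<Rightarrow> int poly" where
  "g_expansion d g = (\<Sum>i\<le>d div 2. smult (g i) (\<Sum>l=i..d-i. monom 1 l))"

text \<open>A g-vector \<open>(g\<^sub>0, \<dots>, g\<^bsub>d div 2\<^esub>)\<close> is represented by its extension by zero.\<close>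

definition is_g_vector :: "nat \<Rightarrow> int poly \<Rightarrow> (nat \<Rightarrow> int) \<Rightarrow> bool" where
  "is_g_vector d h g \<longleftrightarrow> palindromic d h \<and> h = g_expansion d g \<and> (\<forall>i > d div 2. g i = 0)"

definition g_vector :: "nat \<Rightarrow> int poly \<Rightarrow> nat \<Rightarrow> int" where
  "g_vector d h = (THE g. is_g_vector d h g)"

lemma palindromic_iff_coeff:
  "palindromic d h \<longleftrightarrow> (\<forall>c. coeff h c = (if c \<le> d then coeff h (d - c) else 0))"
proof
  assume R: "\<forall>c. coeff h c = (if c \<le> d then coeff h (d - c) else 0)"
  define p where "p = (map_poly of_int h :: rat poly)"
  have cp: "coeff p c = of_int (coeff h c)" for c by (simp add: p_def coeff_map_poly)
  have dp: "degree p \<le> d"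
  proof (rule degree_le, intro allI impI)
    fix c assume "d < c"
    then show "coeff p c = 0" using R[rule_format, of c] by (simp add: cp)
  qed
  have ev: "poly p y = (\<Sum>c\<le>d. coeff p c * y ^ c)" for y
    unfolding poly_altdef using dp
    by (intro sum.mono_neutral_left) (auto simp: coeff_eq_0)
  show "palindromic d h"
    unfolding palindromic_def p_def[symmetric]
  proof (intro allI impI)
    fix x :: rat assume x: "x \<noteq> 0"
    have "x ^ d * poly p (1 / x) = (\<Sum>c\<le>d. coeff p c * x ^ (d - c))"
      unfolding ev sum_distrib_left
      by (rule sum.cong) (use x in \<open>auto simp: power_diff power_divide field_simps\<close>)
    also have "\<dots> = (\<Sum>c\<le>d. coeff p (d - c) * x ^ c)"
      by (rule sum.reindex_bij_witness[of _ "\<lambda>c. d - c" "\<lambda>c. d - c"]) auto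
    also have "\<dots> = poly p x" unfolding ev
    proof (rule sum.cong[OF refl])
      fix c assume "c \<in> {..d}"
      then have "coeff h c = coeff h (d - c)" using R[rule_format, of c] by simp
      then show "coeff p (d - c) * x ^ c = coeff p c * x ^ c" by (simp add: cp)
    qed
    finally show "x ^ d * poly p (1 / x) = poly p x" .
  qed
next
  assume L: "palindromic d h"
  define p where "p = (map_poly of_int h :: rat poly)"
  define n where "n = degree p"
  have cp: "coeff p c = of_int (coeff h c)" for c by (simp add: p_def coeff_map_poly)
  have pe: "poly (monom 1 d * reflect_poly p) x = poly (monom 1 n * p) x" if "x \<noteq> 0" for x
  proof -
    have "poly (reflect_poly p) x = x ^ n * poly p (1 / x)"
      using that by (simp add: poly_reflect_poly_nz n_def inverse_eq_divide)
    moreover have "x ^ d * poly p (1 / x) = poly p x"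
      using L that unfolding palindromic_def p_def by blast
    ultimately show ?thesis by (simp add: poly_monom algebra_simps)
  qed
  have eq: "monom 1 d * reflect_poly p = monom 1 n * p"
  proof (rule ccontr)
    assume "\<not> ?thesis"
    then have "finite {x. poly (monom 1 d * reflect_poly p - monom 1 n * p) x = 0}"
      by (intro poly_roots_finite) simp
    moreover have "UNIV - {0} \<subseteq> {x. poly (monom 1 d * reflect_poly p - monom 1 n * p) x = 0}"
      using pe by auto
    ultimately have "finite (UNIV - {0::rat})" by (rule rev_finite_subset)
    then show False by (simp add: infinite_UNIV_char_0)
  qed
  have symm: "coeff p c = (if c \<le> d then coeff p (d - c) else 0)" for c
  proof -
    have "coeff p (d - c) = 0" if "d > n + c" for c
      using that by (intro coeff_eq_0) (simp add: n_def)
    moreover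
    have "coeff p c = coeff (monom 1 d * reflect_poly p) (n + c)"
      unfolding eq by (simp add: coeff_monom_mult)
    ultimately show ?thesis
      by (auto simp: coeff_monom_mult coeff_reflect_poly n_def[symmetric] coeff_eq_0 split: if_splits)
  qed
  have "(of_int (coeff h c) :: rat) = of_int (if c \<le> d then coeff h (d - c) else 0)" for c
    using symm[of c] by (simp add: cp)
  then show "\<forall>c. coeff h c = (if c \<le> d then coeff h (d - c) else 0)"
    unfolding of_int_eq_iff by blast
qed

lemma coeff_g_expansion:
  "coeff (g_expansion d g) c = (if c \<le> d then \<Sum>i\<le>min c (d - c). g i else 0)"
proof -
  have "coeff (g_expansion d g) c = (\<Sum>i\<le>d div 2. if i \<le> c \<and> c \<le> d - i then g i else 0)"
    unfolding g_expansion_def by (auto simp: coeff_sum intro!: sum.cong)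
  also have "\<dots> = (\<Sum>i\<in>{i. i \<le> d div 2 \<and> i \<le> c \<and> c \<le> d - i}. g i)"
    by (rule sum.mono_neutral_cong_right) auto
  also have "{i. i \<le> d div 2 \<and> i \<le> c \<and> c \<le> d - i} = (if c \<le> d then {..min c (d - c)} else {})"
    by auto
  finally show ?thesis by simp
qed

lemma ex1_g_vector:
  assumes "palindromic d h"
  shows "\<exists>!g. is_g_vector d h g"
proof (rule ex_ex1I)
  have pal: "coeff h c = (if c \<le> d then coeff h (d - c) else 0)" for c
    using assms unfolding palindromic_iff_coeff by (rule spec)
  define g where "g i = (if i > d div 2 then 0 else coeff h i - (if i = 0 then 0 else coeff h (i - 1)))" for i
  have tel: "sum g {..c} = coeff h c" if "c \<le> d div 2" for c
    using that by (induction c) (auto simp: g_def)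
  have "h = g_expansion d g"
  proof (rule poly_eqI)
    fix c
    show "coeff h c = coeff (g_expansion d g) c"
      using pal[of c] tel[of "min c (d - c)"] by (auto simp: coeff_g_expansion min_def split: if_splits)
  qed
  then show "\<exists>g. is_g_vector d h g" using assms unfolding is_g_vector_def g_def by auto
next
  fix g g' assume g: "is_g_vector d h g" and g': "is_g_vector d h g'"
  have S: "sum g {..c} = sum g' {..c}" if "c \<le> d div 2" for c
  proof -
    have "coeff (g_expansion d g) c = coeff (g_expansion d g') c" "min c (d - c) = c" "c \<le> d"
      using g g' that by (auto simp: is_g_vector_def)
    then show ?thesis by (simp add: coeff_g_expansion)
  qed
  show "g = g'"
  proof
    fix i
    show "g i = g' i"
    proof (cases "i \<le> d div 2")
      case True
      then show ?thesis using S[of i] S[of "i - 1"] by (cases i) auto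
    qed (use g g' in \<open>auto simp: is_g_vector_def\<close>)
  qed
qed

lemma g_vector_eq: "is_g_vector d h g \<Longrightarrow> g_vector d h = g"
  unfolding g_vector_def using ex1_g_vector[of d h]
  by (intro the1_equality) (auto simp: is_g_vector_def)


section \<open>q-analogues\<close>

definition q_int :: "nat \<Rightarrow> int poly" where
  "q_int m = (\<Sum>l<m. monom 1 l)"

definition q_fact :: "nat \<Rightarrow> int poly" where
  "q_fact n = (\<Prod>m=1..n. q_int m)"

text \<open>The division is exact, see \<open>q_binomial_mult\<close>.\<close>

definition q_binomial :: "nat \<Rightarrow> nat \<Rightarrow> int poly" where
  "q_binomial n k = q_fact n div (q_fact k * q_fact (n - k))"

lemma q_fact_Suc: "q_fact (Suc n) = q_fact n * q_int (Suc n)"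
  by (simp add: q_fact_def)

lemma q_fact_nonzero: "q_fact n \<noteq> 0"
proof -
  have "coeff (q_int m) 0 = 1" if "m \<ge> 1" for m
    using that by (simp add: q_int_def coeff_sum)
  then have "q_int m \<noteq> 0" if "m \<ge> 1" for m using that by fastforce
  then show ?thesis by (simp add: q_fact_def)
qed

lemma q_int_add: "q_int (a + b) = q_int a + monom 1 a * q_int b"
  by (induction b) (simp_all add: q_int_def algebra_simps mult_monom)

lemma q_fact_dvd: "q_fact a * q_fact b dvd q_fact (a + b)"
proof (induction "a + b" arbitrary: a b)
  case 0
  then show ?case by (simp add: q_fact_def)
next
  case (Suc n)
  show ?case
  proof (cases "a = 0 \<or> b = 0")
    case True
    then show ?thesis by (elim disjE) (simp_all add: q_fact_def)
  next
    case False
    then obtain a' b' where ab: "a = Suc a'" "b = Suc b'" by (meson not0_implies_Suc)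
    have n: "n = a' + b" "n = a + b'" using Suc.hyps(2) ab by auto
    have "q_fact a' * q_fact b * q_int a dvd q_fact n * q_int a"
      using Suc.hyps(1)[OF n(1)] n(1) by (intro mult_dvd_mono) simp_all
    then have 1: "q_fact a * q_fact b dvd q_fact n * q_int a"
      unfolding ab(1) q_fact_Suc by (simp only: mult_ac)
    have "q_fact a * q_fact b' * q_int b dvd q_fact n * q_int b"
      using Suc.hyps(1)[OF n(2)] n(2) by (intro mult_dvd_mono) simp_all
    then have 2: "q_fact a * q_fact b dvd q_fact n * q_int b"
      unfolding ab(2) q_fact_Suc by (simp only: mult_ac)
    have "q_fact (a + b) = q_fact n * q_int (a + b)"
      using q_fact_Suc[of n] Suc.hyps(2) by simp
    also have "\<dots> = q_fact n * q_int a + monom 1 a * (q_fact n * q_int b)"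
      unfolding q_int_add by (simp only: distrib_left mult_ac)
    finally show ?thesis using 1 2 by (simp only: dvd_add dvd_mult)
  qed
qed

lemma q_binomial_mult:
  assumes "k \<le> n"
  shows "q_binomial n k * (q_fact k * q_fact (n - k)) = q_fact n"
proof -
  have "q_fact k * q_fact (n - k) dvd q_fact n"
    using q_fact_dvd[of k "n - k"] assms by simp
  then show ?thesis unfolding q_binomial_def by (rule dvd_div_mult_self)
qed


text \<open>The three polynomials are palindromic, so by \<open>ex1_g_vector\<close> their g-vectors exist.\<close>

lemma map_poly_of_int_mult:
  "(map_poly of_int (p * q) :: rat poly) = map_poly of_int p * map_poly of_int q"
  by (rule poly_eqI) (simp add: coeff_map_poly coeff_mult)

lemma palindromic_mult:
  assumes "palindromic a p" "palindromic b q"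
  shows "palindromic (a + b) (p * q)"
  unfolding palindromic_def
proof (intro allI impI)
  fix x :: rat assume x: "x \<noteq> 0"
  let ?P = "poly (map_poly of_int p)" and ?Q = "poly (map_poly of_int q)"
  have "x ^ (a + b) * (?P (1 / x) * ?Q (1 / x)) = (x ^ a * ?P (1 / x)) * (x ^ b * ?Q (1 / x))"
    by (simp add: power_add)
  also have "\<dots> = ?P x * ?Q x"
    using assms x unfolding palindromic_def by metis
  finally show "x ^ (a + b) * poly (map_poly of_int (p * q)) (1 / x) = poly (map_poly of_int (p * q)) x"
    by (simp add: map_poly_of_int_mult)
qed

lemma palindromic_cancel:
  assumes pq: "palindromic (a + b) (p * q)" and q: "palindromic b q" "q \<noteq> 0"
  shows "palindromic a p"
proof -
  let ?p = "map_poly of_int p :: rat poly" and ?q = "map_poly of_int q :: rat poly"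
  have "?q \<noteq> 0" using q(2) by (simp add: map_poly_eq_0_iff)
  then have fin: "finite {x. poly ?q x = 0}" by (rule poly_roots_finite)
  have good: "x ^ a * poly ?p (1 / x) = poly ?p x" if x: "x \<noteq> 0" "poly ?q x \<noteq> 0" for x
  proof -
    have "(x ^ a * poly ?p (1 / x)) * (x ^ b * poly ?q (1 / x)) = poly ?p x * poly ?q x"
      using pq x(1) unfolding palindromic_def
      by (simp add: map_poly_of_int_mult power_add mult_ac)
    moreover have "x ^ b * poly ?q (1 / x) = poly ?q x"
      using q(1) x(1) unfolding palindromic_def by blast
    ultimately show ?thesis using x(2) by simp
  qed
  define n where "n = degree ?p"
  define r where "r = monom 1 a * reflect_poly ?p - monom 1 n * ?p"
  have r: "poly r x = x ^ n * (x ^ a * poly ?p (1 / x) - poly ?p x)" if "x \<noteq> 0" for x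
    using that by (simp add: r_def n_def poly_monom poly_reflect_poly_nz inverse_eq_divide algebra_simps)
  have "r = 0"
  proof (rule ccontr)
    assume "r \<noteq> 0"
    then have "finite {x. poly r x = 0}" by (rule poly_roots_finite)
    moreover have "UNIV \<subseteq> {x. poly r x = 0} \<union> {x. poly ?q x = 0} \<union> {0}"
      using r good by auto
    ultimately have "finite (UNIV :: rat set)"
      using fin by (meson finite.emptyI finite.insertI finite_UnI finite_subset)
    then show False by (simp add: infinite_UNIV_char_0)
  qed
  then show ?thesis unfolding palindromic_def using r by fastforce
qed

lemma palindromic_q_int: "palindromic m (q_int (Suc m))"
proof -
  have "coeff (q_int (Suc m)) c = (if c \<le> m then 1 else 0)" for c
    by (auto simp: q_int_def coeff_sum less_Suc_eq_le)
  then show ?thesis by (auto simp: palindromic_iff_coeff)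
qed

lemma palindromic_q_fact: "palindromic (n choose 2) (q_fact n)"
proof (induction n)
  case 0
  then show ?case by (simp add: q_fact_def palindromic_def numeral_2_eq_2)
next
  case (Suc n)
  then show ?case
    using palindromic_mult[OF Suc palindromic_q_int[of n]]
    by (simp add: q_fact_Suc numeral_2_eq_2 add.commute)
qed

lemma palindromic_prod: "palindromic ((n + 1) choose 2) (\<Prod>m=1..n. 1 + monom 1 m)"
proof (induction n)
  case 0
  then show ?case by (simp add: palindromic_def numeral_2_eq_2)
next
  case (Suc n)
  have "palindromic (Suc n) (1 + monom 1 (Suc n))"
    by (auto simp: palindromic_iff_coeff)
  from palindromic_mult[OF Suc this] show ?case
    by (simp add: numeral_2_eq_2 add_ac mult.commute)
qed

lemma palindromic_q_binomial:
  assumes "k \<le> n"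
  shows "palindromic (k * (n - k)) (q_binomial n k)"
proof -
  have "k * m + ((k choose 2) + (m choose 2)) = (k + m) choose 2" for m
    by (induction m) (simp_all add: numeral_2_eq_2)
  from this[of "n - k"] have *: "k * (n - k) + ((k choose 2) + ((n - k) choose 2)) = n choose 2"
    using assms by simp
  show ?thesis
  proof (rule palindromic_cancel)
    show "palindromic (k * (n - k) + ((k choose 2) + ((n - k) choose 2)))
        (q_binomial n k * (q_fact k * q_fact (n - k)))"
      unfolding * q_binomial_mult[OF assms] by (rule palindromic_q_fact)
    show "palindromic ((k choose 2) + ((n - k) choose 2)) (q_fact k * q_fact (n - k))"
      by (intro palindromic_mult palindromic_q_fact)
  qed (simp add: q_fact_nonzero)
qed


section \<open>Ballot paths\<close>

datatype step = East | North

text \<open>The length \<open>d - 2j\<close> and the number \<open>i - j\<close> of north steps are stated additively, so that the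
  set is empty when one of these differences is negative.\<close>

definition ballot_paths :: "nat \<Rightarrow> nat \<Rightarrow> nat \<Rightarrow> step list set" where
  "ballot_paths d i j =
     {w. length w + 2 * j = d \<and> count_list w North + j = i \<and>
         (\<forall>l\<le>length w. count_list (take l w) North \<le> count_list (take l w) East)}"

lemma ballot_paths_empty: "i < j \<Longrightarrow> ballot_paths d i j = {}"
  by (auto simp: ballot_paths_def)


section \<open>Matchings of paths and cycles\<close>

text \<open>A multigraph is given by a set of edge names and the sets of their endpoints, so that parallel
  edges are distinguished. A loop has a single endpoint and cannot be used in a matching.\<close>

definition matching :: "'e set \<Rightarrow> ('e \<Rightarrow> 'v set) \<Rightarrow> 'e set \<Rightarrow> bool" where
  "matching E ends M \<longleftrightarrow> M \<subseteq> E \<and> (\<forall>e\<in>M. card (ends e) = 2) \<and> disjoint_family_on ends M"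

text \<open>The vertices of the path and of the cycle are \<open>0, \<dots>, m - 1\<close>. For \<open>m = 1\<close> the cycle has a loop,
  for \<open>m = 2\<close> it has two parallel edges.\<close>

definition path_ends :: "nat \<Rightarrow> nat set" where
  "path_ends e = {e, Suc e}"

definition path_matching :: "nat \<Rightarrow> nat set \<Rightarrow> bool" where
  "path_matching m M \<longleftrightarrow> matching {e. Suc e < m} path_ends M"

definition cycle_ends :: "nat \<Rightarrow> nat \<Rightarrow> nat set" where
  "cycle_ends m e = {e, Suc e mod m}"

definition cycle_matching :: "nat \<Rightarrow> nat set \<Rightarrow> bool" where
  "cycle_matching m M \<longleftrightarrow> matching {..<m} (cycle_ends m) M"

definition path_matchings :: "nat \<Rightarrow> nat \<Rightarrow> nat set set" where
  "path_matchings m j = {M. path_matching m M \<and> card M = j}"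

definition cycle_matchings :: "nat \<Rightarrow> nat \<Rightarrow> nat set set" where
  "cycle_matchings m j = {M. cycle_matching m M \<and> card M = j}"

text \<open>Tuples are lists; \<open>listset [A\<^sub>1, \<dots>, A\<^sub>r]\<close> is the product of the sets \<open>A\<^sub>1, \<dots>, A\<^sub>r\<close>.\<close>

definition path_matching_tuples :: "nat \<Rightarrow> nat \<Rightarrow> nat set list set" where
  "path_matching_tuples n j =
     (\<Union>js\<in>{js. length js = n - 1 \<and> sum_list js = j}. listset (map2 path_matchings [1..<n] js))"

definition cycle_matching_tuples :: "nat \<Rightarrow> nat \<Rightarrow> nat set list set" where
  "cycle_matching_tuples n j =
     (\<Union>js\<in>{js. length js = n \<and> sum_list js = j}. listset (map2 cycle_matchings [1..<n+1] js))"


section \<open>Lucanomial matchings\<close>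

definition fits_in_rectangle :: "nat list \<Rightarrow> nat \<Rightarrow> nat \<Rightarrow> bool" where
  "fits_in_rectangle lam k m \<longleftrightarrow>
     length lam = k \<and> sorted_wrt (\<ge>) lam \<and> (\<forall>x\<in>set lam. x \<le> m)"

text \<open>The list of the parts \<open>k - #{s. \<lambda>\<^sub>s \<ge> m + 1 - r}\<close> for \<open>r = 1, \<dots>, m\<close>; list positions \<open>s\<close>
  start at 0. Neither subtraction truncates.\<close>

definition complement_partition :: "nat \<Rightarrow> nat \<Rightarrow> nat list \<Rightarrow> nat list" where
  "complement_partition k m lam =
     map (\<lambda>r. k - card {s. s < k \<and> lam ! s \<ge> m + 1 - r}) [1..<m+1]"

definition strict_path_matching :: "nat \<Rightarrow> nat set \<Rightarrow> bool" where
  "strict_path_matching m M \<longleftrightarrow> path_matching m M \<and> (m = 0 \<or> (\<exists>e\<in>M. 0 \<in> path_ends e))"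

definition lucanomial_matchings ::
    "nat \<Rightarrow> nat \<Rightarrow> nat \<Rightarrow> (nat list \<times> nat set list \<times> nat set list) set" where
  "lucanomial_matchings n k j =
     {(lam, Ms, Ms'). fits_in_rectangle lam k (n - k) \<and>
        list_all2 path_matching lam Ms \<and>
        list_all2 strict_path_matching (complement_partition k (n - k) lam) Ms' \<and>
        sum_list (map card (Ms @ Ms')) = j}"

end

theory Submission
  imports Defs
begin

text \<open>Put \<open>s = 1 + q\<close> and \<open>t = -q\<close>. The \<open>q\<close>-integers satisfy the Lucas recurrence
  \<open>[m + 2] = s [m + 1] + t [m]\<close>, which is also the recurrence for the matchings of a path with
  \<open>m + 1\<close> vertices in which an isolated vertex has weight \<open>s\<close> and an edge has weight \<open>t\<close>. Hence
  each of the three polynomials \<open>h\<close> is a sum, over the matchings in question, of terms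
  \<open>t\<^sup>j s\<^bsup>d - 2j\<^esup>\<close>, where \<open>j\<close> is the number of edges. As \<open>q\<^sup>j (1 + q)\<^bsup>d - 2j\<^esup>\<close> has the coefficients
  \<open>d - 2j choose i - j\<close>, its \<open>g\<close>-vector consists of differences of adjacent binomial
  coefficients, which are the ballot numbers. For the \<open>q\<close>-binomial coefficients, splitting the
  partitions according to whether the first part is maximal gives the recurrence
  \<open>[m + 2] [k + 1] + t [k] [m + 1] = [k + m + 2]\<close> after multiplication by the \<open>q\<close>-factorials.\<close>

section \<open>Ballot numbers\<close>

text \<open>Indexed by length and number of norths, because the induction removes the last letter;
  this changes the parameters of \<open>ballot_paths\<close> less conveniently.\<close>

definition ballot_words :: "nat \<Rightarrow> nat \<Rightarrow> step list set" where
  "ballot_words n a = {w. length w = n \<and> count_list w North = a \<and>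
     (\<forall>l\<le>length w. count_list (take l w) North \<le> count_list (take l w) East)}"

lemma count_North_East: "count_list w North + count_list w East = length w"
proof (induction w)
  case (Cons x w)
  then show ?case by (cases x) auto
qed simp

lemma finite_ballot_words: "finite (ballot_words n a)"
proof -
  have "(UNIV :: step set) = {East, North}"
    using step.exhaust by auto
  then have "finite (UNIV :: step set)"
    by (metis finite.emptyI finite.insertI)
  then have "finite {w. set w \<subseteq> (UNIV :: step set) \<and> length w = n}"
    by (rule finite_lists_length_eq)
  then show ?thesis
    by (rule rev_finite_subset) (auto simp: ballot_words_def)
qed

text \<open>Only the condition on the full-length prefix is new. As easts and norths add up to the
  length, it says \<open>2 * a \<le> Suc n\<close>.\<close>

lemma ballot_words_snoc:
  "w @ [x] \<in> ballot_words (Suc n) a \<longleftrightarrow>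
     2 * a \<le> Suc n \<and> w \<in> ballot_words n (count_list w North) \<and>
     a = count_list w North + (if x = North then 1 else 0)"
  using count_North_East[of "w @ [x]"] count_North_East[of w]
  by (cases x) (auto simp: ballot_words_def le_Suc_eq all_conj_distrib)

lemma ballot_words_eq_empty:
  assumes "n < 2 * a"
  shows "ballot_words n a = {}"
proof -
  have "2 * count_list w North \<le> length w"
    if "\<forall>l\<le>length w. count_list (take l w) North \<le> count_list (take l w) East" for w
    using that[rule_format, of "length w"] count_North_East[of w] by simp
  then show ?thesis using assms by (fastforce simp: ballot_words_def)
qed

lemma ballot_words_Suc:
  assumes "2 * a \<le> Suc n"
  shows "ballot_words (Suc n) a =
    (\<lambda>w. w @ [East]) ` ballot_words n a \<union>
    (if a = 0 then {} else (\<lambda>w. w @ [North]) ` ballot_words n (a - 1))" (is "?L = ?R")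
proof -
  have "w \<in> ?L \<longleftrightarrow> w \<in> ?R" for w
  proof (cases w rule: rev_cases)
    case Nil
    then show ?thesis by (auto simp: ballot_words_def)
  next
    case (snoc v x)
    have count: "v \<in> ballot_words n c \<longleftrightarrow> 
        v \<in> ballot_words n (count_list v North) \<and> count_list v North = c" for c
      by (auto simp: ballot_words_def)
    show ?thesis
      unfolding snoc ballot_words_snoc using assms count[of a] count[of "a - 1"]
      by (cases x) auto
  qed
  then show ?thesis by blast
qed

lemma card_ballot_words_Suc:
  assumes "2 * a \<le> Suc n"
  shows "card (ballot_words (Suc n) a) =
    card (ballot_words n a) + (if a = 0 then 0 else card (ballot_words n (a - 1)))"
proof (cases "a = 0")
  case True
  then show ?thesis by (simp add: ballot_words_Suc card_image inj_on_def)
next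
  case False
  have "card (ballot_words (Suc n) a) = card ((\<lambda>w. w @ [East]) ` ballot_words n a) +
      card ((\<lambda>w. w @ [North]) ` ballot_words n (a - 1))"
    unfolding ballot_words_Suc[OF assms] using False
    by (simp only: if_False) (intro card_Un_disjoint, auto simp: finite_ballot_words)
  then show ?thesis using False by (simp add: card_image inj_on_def)
qed

text \<open>Both sides obey Pascal's rule. The range includes \<open>2 * a = Suc n\<close>, where
  both sides are 0, because the induction step calls on this boundary.\<close>

lemma card_ballot_words:
  "2 * a \<le> Suc n \<Longrightarrow>
     int (card (ballot_words n a)) = int (n choose a) - (if a = 0 then 0 else int (n choose (a - 1)))"
proof (induction n arbitrary: a)
  case 0
  then have "ballot_words 0 a = {[]}" "a = 0" by (auto simp: ballot_words_def)
  then show ?case by simp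
next
  case (Suc n)
  show ?case
  proof (cases "2 * a \<le> Suc n")
    case True
    then show ?thesis
      using Suc.IH[of a] Suc.IH[of "a - 1"] card_ballot_words_Suc[OF True]
      by (cases a; cases "a - 1") auto
  next
    case False
    \<comment> \<open>On the boundary there are no ballot words, and the two binomials agree by
      symmetry.\<close>
    then have a: "2 * a = Suc (Suc n)" using Suc.prems by simp
    then have "a \<le> Suc n" "Suc n - a = a - 1" by linarith+
    then have "Suc n choose a = Suc n choose (a - 1)"
      using binomial_symmetric[of a "Suc n"] by simp
    then show ?thesis using a ballot_words_eq_empty[of "Suc n" a] by simp
  qed
qed

section \<open>The g-vector of a sum of gamma terms\<close>

text \<open>The weight of a matching with \<open>j\<close> edges on \<open>d\<close> vertices:
  \<open>-q\<close> for each edge and \<open>1 + q\<close> for each of the \<open>d - 2 * j\<close>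
  isolated vertices.\<close>

definition gamma_term :: "nat \<Rightarrow> nat \<Rightarrow> int poly" where
  "gamma_term d j = monom ((-1) ^ j) j * [:1, 1:] ^ (d - 2 * j)"

lemma gamma_term_mult:
  assumes "2 * i \<le> a" "2 * j \<le> b"
  shows "gamma_term a i * gamma_term b j = gamma_term (a + b) (i + j)"
proof -
  have "a + b - 2 * (i + j) = (a - 2 * i) + (b - 2 * j)" using assms by simp
  then show ?thesis
    by (simp add: gamma_term_def power_add mult_monom[symmetric] mult_ac)
qed

lemma coeff_one_plus_X_power: "coeff ([:1, 1:] ^ n :: int poly) c = int (n choose c)"
proof (induction n arbitrary: c)
  case (Suc n)
  then show ?case by (cases c) auto
qed (simp add: coeff_1)

lemma coeff_gamma_term:
  "coeff (gamma_term d j) c = (if j \<le> c then (-1) ^ j * int ((d - 2 * j) choose (c - j)) else 0)"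
  by (simp add: gamma_term_def coeff_monom_mult coeff_one_plus_X_power)

lemma ballot_paths_eq_ballot_words:
  assumes "2 * j \<le> d"
  shows "ballot_paths d i j = (if j \<le> i then ballot_words (d - 2 * j) (i - j) else {})"
  using assms by (auto simp: ballot_paths_def ballot_words_def)

text \<open>Up to sign the coefficients are the binomials \<open>d - 2 * j\<close> over
  \<open>i - j\<close>, and \<open>2 * i \<le> d\<close> puts \<open>i - j\<close> into the range of
  \<open>card_ballot_words\<close>.\<close>

lemma gamma_term_diff_coeff:
  assumes "2 * j \<le> d" "2 * i \<le> d"
  shows "coeff (gamma_term d j) i - (if i = 0 then 0 else coeff (gamma_term d j) (i - 1)) =
    (-1) ^ j * int (card (ballot_paths d i j))"
proof (cases "j \<le> i")
  case True
  then show ?thesis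
    using assms card_ballot_words[of "i - j" "d - 2 * j"]
    by (auto simp: coeff_gamma_term ballot_paths_eq_ballot_words right_diff_distrib)
qed (use assms in \<open>auto simp: coeff_gamma_term ballot_paths_eq_ballot_words\<close>)

lemma g_vector_eq_diff_coeff:
  assumes "palindromic d h"
  shows "g_vector d h i =
    (if 2 * i \<le> d then coeff h i - (if i = 0 then 0 else coeff h (i - 1)) else 0)"
proof -
  obtain g where g: "is_g_vector d h g" using ex1_g_vector[OF assms] by blast
  then have h: "h = g_expansion d g" and z: "\<And>i. i > d div 2 \<Longrightarrow> g i = 0"
    by (auto simp: is_g_vector_def)
  have c: "coeff h c = sum g {..c}" if "2 * c \<le> d" for c
    using that by (simp add: h coeff_g_expansion min_def)
  have "g i = coeff h i - (if i = 0 then 0 else coeff h (i - 1))" if "2 * i \<le> d"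
    using that c[of i] c[of "i - 1"] by (cases i) auto
  then show ?thesis using g_vector_eq[OF g] z[of i] by auto
qed

text \<open>Reduces each item of the theorem to an expansion of \<open>h\<close> into gamma terms.
  The \<open>g\<close>-vector is linear in \<open>h\<close>, so each \<open>x\<close> contributes a
  signed ballot number; these are then grouped by the number of edges.\<close>

lemma g_vector_sum_gamma_term:
  fixes A :: "'a set" and edges :: "'a \<Rightarrow> nat"
  assumes pal: "palindromic d h" and h: "h = (\<Sum>x\<in>A. gamma_term d (edges x))"
    and fin: "finite A" and le: "\<And>x. x \<in> A \<Longrightarrow> 2 * edges x \<le> d"
    and T: "\<And>j. T j = {x \<in> A. edges x = j}"
  shows "g_vector d h i = (\<Sum>j. (-1) ^ j * int (card (T j \<times> ballot_paths d i j)))"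
proof -
  \<comment> \<open>Beyond the middle degree the \<open>g\<close>-vector is extended by 0, so the
    right-hand side has to vanish there too.\<close>
  have "ballot_paths d i j = {}" if "2 * j \<le> d" "\<not> 2 * i \<le> d" for j
    using that by (simp add: ballot_paths_eq_ballot_words ballot_words_eq_empty)
  then have "g_vector d h i = (\<Sum>x\<in>A. (-1) ^ edges x * int (card (ballot_paths d i (edges x))))"
    using le
    by (cases "2 * i \<le> d")
      (simp_all add: g_vector_eq_diff_coeff[OF pal] gamma_term_diff_coeff[symmetric] sum_subtractf,
        simp_all add: h coeff_sum)
  also have "\<dots> = (\<Sum>j\<le>d. \<Sum>x\<in>{x \<in> A. edges x = j}.
      (-1) ^ edges x * int (card (ballot_paths d i (edges x))))"
    by (rule sum.group[symmetric]) (use fin le in force)+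
  also have "\<dots> = (\<Sum>j\<le>d. (-1) ^ j * int (card (T j \<times> ballot_paths d i j)))"
    by (simp add: T card_cartesian_product mult_ac)
  also have "\<dots> = (\<Sum>j. (-1) ^ j * int (card (T j \<times> ballot_paths d i j)))"
  \<comment> \<open>No \<open>x\<close> has more than \<open>d\<close> edges, so the series is a
    finite sum.\<close>
  proof (rule suminf_finite[symmetric])
    fix j assume "j \<notin> {..d}"
    then have "T j = {}" using le by (fastforce simp: T)
    then show "(-1) ^ j * int (card (T j \<times> ballot_paths d i j)) = 0" by simp
  qed simp
  finally show ?thesis .
qed

section \<open>Generating polynomials of matchings\<close>

text \<open>The predicate is a parameter so that paths, strict paths and cycles share the product
  formula for tuples.\<close>

definition matching_gf :: "(nat \<Rightarrow> nat set \<Rightarrow> bool) \<Rightarrow> nat \<Rightarrow> int poly" where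
  "matching_gf P m = (\<Sum>M | P m M. gamma_term m (card M))"

lemma card_matching_le:
  assumes "matching E ends M" "finite V" "\<And>e. e \<in> M \<Longrightarrow> ends e \<subseteq> V" "finite M"
  shows "2 * card M \<le> card V"
proof -
  have "card (\<Union>e\<in>M. ends e) = (\<Sum>e\<in>M. card (ends e))"
    using assms by (intro card_UN_disjoint) (auto simp: matching_def disjoint_family_on_def intro: finite_subset)
  also have "\<dots> = 2 * card M" using assms by (simp add: matching_def)
  finally show ?thesis using card_mono[OF assms(2), of "\<Union>e\<in>M. ends e"] assms(3) by fastforce
qed

lemma card_path_matching_le:
  assumes "path_matching m M"
  shows "2 * card M \<le> m"
proof -
  have M: "matching {e. Suc e < m} path_ends M" "M \<subseteq> {e. Suc e < m}"
    using assms by (simp_all add: path_matching_def matching_def)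
  then have "M \<subseteq> {..<m}" by auto
  then have "finite M" using finite_subset by blast
  moreover have "path_ends e \<subseteq> {..<m}" if "e \<in> M" for e
    using that M(2) by (auto simp: path_ends_def)
  ultimately show ?thesis
    using card_matching_le[OF M(1), of "{..<m}"] by simp
qed

lemma card_cycle_matching_le:
  assumes "cycle_matching m M"
  shows "2 * card M \<le> m"
proof -
  have M: "matching {..<m} (cycle_ends m) M" "M \<subseteq> {..<m}"
    using assms by (simp_all add: cycle_matching_def matching_def)
  then have "finite M" using finite_subset by blast
  moreover have "cycle_ends m e \<subseteq> {..<m}" if "e \<in> M" for e
  proof -
    have "e < m" using M(2) that by auto
    moreover from this have "Suc e mod m < m" by (intro mod_less_divisor) simp
    ultimately show ?thesis by (simp add: cycle_ends_def)
  qed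
  ultimately show ?thesis
    using card_matching_le[OF M(1), of "{..<m}"] by simp
qed

section \<open>Matchings of paths and the q-integers\<close>

lemma path_matching_iff: "path_matching m M \<longleftrightarrow> (\<forall>e\<in>M. Suc e < m \<and> Suc e \<notin> M)"
  by (fastforce simp: path_matching_def matching_def path_ends_def disjoint_family_on_def)

lemma finite_path_matchings: "finite {M. path_matching m M}"
  by (rule finite_subset[of _ "Pow {..<m}"]) (auto simp: path_matching_iff)

lemma finite_strict_path_matchings: "finite {M. strict_path_matching m M}"
  by (rule finite_subset[OF _ finite_path_matchings[of m]]) (auto simp: strict_path_matching_def)

lemma finite_cycle_matchings: "finite {M. cycle_matching m M}"
  by (rule finite_subset[of _ "Pow {..<m}"]) (auto simp: cycle_matching_def matching_def)

lemma path_matching_0_1: "m \<le> 1 \<Longrightarrow> path_matching m M \<longleftrightarrow> M = {}"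
  by (auto simp: path_matching_iff)

lemma finite_path_matching: "path_matching m M \<Longrightarrow> finite M"
  by (rule finite_subset[of _ "{..<m}"]) (auto simp: path_matching_iff)

text \<open>Vertex 0 is isolated; deleting it shifts the edges by one.\<close>

lemma path_matchings_without_first:
  "{M. path_matching (Suc m) M \<and> 0 \<notin> M} = image Suc ` {M. path_matching m M}" (is "?L = ?R")
proof (intro subset_antisym subsetI)
  fix M assume "M \<in> ?L"
  then have "path_matching m {e. Suc e \<in> M}" "M = Suc ` {e. Suc e \<in> M}"
    by (auto simp: path_matching_iff image_iff) (metis not0_implies_Suc)
  then show "M \<in> ?R" by blast
qed (auto simp: path_matching_iff)

text \<open>Edge 0 occupies the vertices 0 and 1; deleting both leaves a path with \<open>m\<close>
  vertices.\<close>

lemma path_matchings_with_first: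
  "{M. path_matching (m + 2) M \<and> 0 \<in> M} =
     (\<lambda>M. insert 0 ((\<lambda>e. e + 2) ` M)) ` {M. path_matching m M}" (is "?L = ?R")
proof (intro subset_antisym subsetI)
  fix M assume M: "M \<in> ?L"
  then have "Suc 0 \<notin> M" by (auto simp: path_matching_iff)
  then have "M = insert 0 ((\<lambda>e. e + 2) ` {e. e + 2 \<in> M})"
    using M by (auto simp: image_iff) (metis One_nat_def add_2_eq_Suc' not0_implies_Suc)
  moreover have "path_matching m {e. e + 2 \<in> M}" using M by (auto simp: path_matching_iff)
  ultimately show "M \<in> ?R" by blast
qed (auto simp: path_matching_iff)

lemma gamma_term_isolated: "2 * j \<le> m \<Longrightarrow> gamma_term (Suc m) j = [:1, 1:] * gamma_term m j"
  using gamma_term_mult[of 0 1 j m] by (simp add: gamma_term_def)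

lemma gamma_term_edge: "2 * j \<le> m \<Longrightarrow> gamma_term (m + 2) (Suc j) = - [:0, 1:] * gamma_term m j"
  by (simp add: gamma_term_def monom_Suc minus_monom[symmetric])

text \<open>Separate from the recurrence because the same sum gives the strict matchings of paths
  with at least two vertices.\<close>

lemma sum_path_matchings_with_first:
  "(\<Sum>M | path_matching (m + 2) M \<and> 0 \<in> M. gamma_term (m + 2) (card M)) =
     - [:0, 1:] * matching_gf path_matching m"
proof -
  have inj: "inj_on (\<lambda>M. insert 0 ((\<lambda>e. e + 2) ` M)) {M. path_matching m M}"
    by (rule inj_onI) (auto simp: set_eq_iff image_iff)
  have "gamma_term (m + 2) (card (insert 0 ((\<lambda>e. e + 2) ` M))) = - [:0, 1:] * gamma_term m (card M)"
    if "path_matching m M" for M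
  proof -
    have "card (insert 0 ((\<lambda>e. e + 2) ` M)) = Suc (card M)"
      using finite_path_matching[OF that] by (subst card_insert_disjoint) (auto simp: card_image inj_on_def)
    then show ?thesis
      using gamma_term_edge[OF card_path_matching_le[OF that]] by simp
  qed
  then show ?thesis
    unfolding path_matchings_with_first sum.reindex[OF inj] matching_gf_def sum_distrib_left
    by (intro sum.cong) auto
qed

lemma matching_gf_path_rec:
  "matching_gf path_matching (m + 2) =
     [:1, 1:] * matching_gf path_matching (m + 1) - [:0, 1:] * matching_gf path_matching m"
proof -
  have eq: "{M. path_matching (m + 2) M} =
      {M. path_matching (Suc (m + 1)) M \<and> 0 \<notin> M} \<union> {M. path_matching (m + 2) M \<and> 0 \<in> M}" by auto
  have "matching_gf path_matching (m + 2) =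
      (\<Sum>M | path_matching (Suc (m + 1)) M \<and> 0 \<notin> M. gamma_term (m + 2) (card M)) +
      (\<Sum>M | path_matching (m + 2) M \<and> 0 \<in> M. gamma_term (m + 2) (card M))"
    unfolding matching_gf_def eq
    using finite_path_matchings[of "m + 2"] by (intro sum.union_disjoint) auto
  also have "(\<Sum>M | path_matching (Suc (m + 1)) M \<and> 0 \<notin> M. gamma_term (m + 2) (card M)) =
      [:1, 1:] * matching_gf path_matching (m + 1)"
  proof -
    have inj: "inj_on (image Suc) X" for X by (rule inj_onI) (simp add: inj_image_eq_iff)
    show ?thesis
      unfolding path_matchings_without_first sum.reindex[OF inj] matching_gf_def sum_distrib_left
    proof (intro sum.cong refl)
      fix M assume "M \<in> {M. path_matching (m + 1) M}"
      then show "((\<lambda>M. gamma_term (m + 2) (card M)) \<circ> (`) Suc) M =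
          [:1, 1:] * gamma_term (m + 1) (card M)"
        using gamma_term_isolated[OF card_path_matching_le, of "m + 1" M] by (simp add: card_image)
    qed
  qed
  finally show ?thesis unfolding sum_path_matchings_with_first by simp
qed

lemma q_int_Suc: "q_int (Suc m) = 1 + [:0, 1:] * q_int m"
  using q_int_add[of 1 m] by (simp add: q_int_def monom_Suc)

lemma q_int_Suc': "q_int (Suc m) = q_int m + monom 1 m"
  by (simp add: q_int_def)

text \<open>The recurrence is that of the \<open>q\<close>-integers, shifted by one: the empty path
  has value \<open>[1] = 1\<close>.\<close>

lemma matching_gf_path: "matching_gf path_matching m = q_int (Suc m)"
proof (induction m rule: induct_nat_012)
  case 0
  then show ?case by (simp add: matching_gf_def path_matching_0_1 gamma_term_def q_int_def)
next
  case 1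
  then show ?case by (simp add: matching_gf_def path_matching_0_1 gamma_term_def q_int_def monom_Suc one_pCons)
next
  case (ge2 m)
  have "matching_gf path_matching (Suc (Suc m)) =
      [:1, 1:] * q_int (Suc (Suc m)) - [:0, 1:] * q_int (Suc m)"
    using matching_gf_path_rec[of m] ge2 by simp
  also have "\<dots> = q_int (Suc (Suc (Suc m)))"
  proof -
    \<comment> \<open>Once \<open>[m + 3] = 1 + q [m + 2]\<close> is inserted, it remains that
      \<open>[m + 2] - q [m + 1] = 1\<close>.\<close>
    have "[:1, 1:] = (1 :: int poly) + [:0, 1:]" by (simp add: one_pCons)
    then show ?thesis
      by (simp only: q_int_Suc[of "Suc (Suc m)"] distrib_right) (simp add: q_int_Suc[of "Suc m"])
  qed
  finally show ?case .
qed

section \<open>Strict matchings of paths\<close>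

lemma strict_path_matching_iff:
  "strict_path_matching m M \<longleftrightarrow> path_matching m M \<and> (m = 0 \<or> 0 \<in> M)"
  by (auto simp: strict_path_matching_def path_ends_def)

lemma matching_gf_strict_0: "matching_gf strict_path_matching 0 = 1"
  by (simp add: matching_gf_def strict_path_matching_iff path_matching_0_1 gamma_term_def)

text \<open>Edge 0 is forced and leaves a path with \<open>m - 1\<close> vertices. For
  \<open>m = 0\<close>, \<open>[0] = 0\<close> reflects that one vertex has no strict
  matching.\<close>

lemma matching_gf_strict_Suc: "matching_gf strict_path_matching (Suc m) = - ([:0, 1:] * q_int m)"
proof (cases m)
  case 0
  then have "{M. strict_path_matching (Suc m) M} = {}"
    by (auto simp: strict_path_matching_iff path_matching_0_1)
  then show ?thesis using 0 by (simp add: matching_gf_def q_int_def)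
next
  case (Suc l)
  then show ?thesis
    using sum_path_matchings_with_first[of l]
    by (simp add: matching_gf_def[of strict_path_matching] strict_path_matching_iff matching_gf_path)
qed

section \<open>Matchings of cycles\<close>

lemma cycle_matching_iff:
  assumes "m \<ge> 2"
  shows "cycle_matching m M \<longleftrightarrow> (\<forall>e\<in>M. e < m \<and> Suc e mod m \<notin> M)"
proof -
  \<comment> \<open>\<open>m \<ge> 2\<close> excludes the loop. Distinct edges then meet exactly if
    one follows the other cyclically, which for \<open>m = 2\<close> covers the parallel
    edges.\<close>
  have c: "card (cycle_ends m e) = 2" "Suc e mod m \<noteq> e" if "e < m" for e
    using that assms by (auto simp: cycle_ends_def mod_Suc)
  have inj: "e = f" if "e < m" "f < m" "Suc e mod m = Suc f mod m" for e f
    using that by (auto simp: mod_Suc split: if_splits)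
  show ?thesis
  proof
    assume M: "cycle_matching m M"
    show "\<forall>e\<in>M. e < m \<and> Suc e mod m \<notin> M"
    proof (intro ballI conjI notI)
      fix e assume e: "e \<in> M"
      then show em: "e < m" using M by (auto simp: cycle_matching_def matching_def)
      assume f: "Suc e mod m \<in> M"
      then have "cycle_ends m e \<inter> cycle_ends m (Suc e mod m) = {}"
        using M e c(2)[OF em] unfolding cycle_matching_def matching_def disjoint_family_on_def
        by metis
      then show False by (simp add: cycle_ends_def)
    qed
  next
    assume M: "\<forall>e\<in>M. e < m \<and> Suc e mod m \<notin> M"
    have "cycle_ends m e \<inter> cycle_ends m f = {}" if "e \<in> M" "f \<in> M" "e \<noteq> f" for e f
    proof -
      have "Suc e mod m \<noteq> f" "Suc f mod m \<noteq> e" "Suc e mod m \<noteq> Suc f mod m"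
        using M inj that by metis+
      then show ?thesis using that(3) by (auto simp: cycle_ends_def)
    qed
    then show "cycle_matching m M"
      using M c(1) by (auto simp: cycle_matching_def matching_def disjoint_family_on_def)
  qed
qed

text \<open>Edge \<open>m + 1\<close> closes the cycle by joining the vertices \<open>m + 1\<close>
  and 0; without it a path remains.\<close>

lemma cycle_matchings_without_last:
  "cycle_matching (m + 2) M \<and> m + 1 \<notin> M \<longleftrightarrow> path_matching (m + 2) M"
proof
  assume M: "cycle_matching (m + 2) M \<and> m + 1 \<notin> M"
  show "path_matching (m + 2) M"
    unfolding path_matching_iff
  proof
    fix e assume e: "e \<in> M"
    then have "e < m + 2" "Suc e mod (m + 2) \<notin> M" "e \<noteq> m + 1"
      using M by (auto simp: cycle_matching_iff)
    then show "Suc e < m + 2 \<and> Suc e \<notin> M" by simp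
  qed
next
  assume M: "path_matching (m + 2) M"
  then have lt: "Suc e < m + 2" "Suc e \<notin> M" if "e \<in> M" for e
    using that by (simp_all add: path_matching_iff)
  have "e < m + 2 \<and> Suc e mod (m + 2) \<notin> M" if "e \<in> M" for e
    using lt[OF that] by simp
  then have "cycle_matching (m + 2) M" by (simp add: cycle_matching_iff)
  then show "cycle_matching (m + 2) M \<and> m + 1 \<notin> M" using lt(1)[of "m + 1"] by auto
qed

text \<open>The closing edge covers the vertices \<open>m + 1\<close> and 0, so the other edges
  match the path on the vertices 1 to \<open>m\<close>.\<close>

lemma cycle_matchings_with_last:
  "{M. cycle_matching (m + 2) M \<and> m + 1 \<in> M} =
     (\<lambda>M. insert (m + 1) (Suc ` M)) ` {M. path_matching m M}" (is "?L = ?R")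
proof (intro subset_antisym subsetI)
  fix M assume "M \<in> ?L"
  then have M: "\<And>e. e \<in> M \<Longrightarrow> e < m + 2 \<and> Suc e mod (m + 2) \<notin> M" and last: "m + 1 \<in> M"
    by (auto simp: cycle_matching_iff)
  have zero: "0 \<notin> M" and m: "m \<notin> M" using M[of "m + 1"] M[of m] last by auto
  \<comment> \<open>\<open>e \<noteq> m\<close> keeps the closing edge \<open>Suc m\<close> out of
    the preimage.\<close>
  define N where "N = {e. Suc e \<in> M \<and> e \<noteq> m}"
  have "x \<in> insert (m + 1) (Suc ` N)" if "x \<in> M" for x
    using that zero by (cases x) (auto simp: N_def)
  then have "M = insert (m + 1) (Suc ` N)" using last by (auto simp: N_def)
  moreover have "path_matching m N"
    unfolding path_matching_iff
  proof
    fix e assume e: "e \<in> N"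
    then have "Suc e \<in> M" "e \<noteq> m" by (auto simp: N_def)
    then have "e < m" "Suc e \<noteq> m" using M[of "Suc e"] m by auto
    moreover have "Suc (Suc e) \<notin> M" using M[OF \<open>Suc e \<in> M\<close>] \<open>e < m\<close> by simp
    ultimately show "Suc e < m \<and> Suc e \<notin> N" by (auto simp: N_def)
  qed
  ultimately show "M \<in> ?R" by blast
next
  fix M assume "M \<in> ?R"
  then obtain N where N: "path_matching m N" "M = insert (m + 1) (Suc ` N)" by blast
  have "e < m + 2 \<and> Suc e mod (m + 2) \<notin> M" if e: "e \<in> M" for e
  proof (cases "e = m + 1")
    case False
    then obtain f where "e = Suc f" "f \<in> N" using e N(2) by blast
    then show ?thesis using N by (auto simp: path_matching_iff)
  qed (simp add: N(2))
  then show "M \<in> ?L" using N(2) by (simp add: cycle_matching_iff)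
qed

text \<open>For \<open>m \<ge> 2\<close>, splitting by use of the closing edge gives
  \<open>[m + 1] - q [m - 1]\<close>. For \<open>m = 1\<close> only the empty matching exists, of
  weight \<open>1 + q\<close>.\<close>

lemma matching_gf_cycle:
  assumes "m \<ge> 1"
  shows "matching_gf cycle_matching m = 1 + monom 1 m"
proof (cases "m = 1")
  case True
  have "{M. cycle_matching 1 M} = {{}}"
  proof (intro set_eqI iffI)
    fix M assume "M \<in> {M. cycle_matching 1 M}"
    then have "M \<subseteq> {..<1}" "2 * card M \<le> 1"
      using card_cycle_matching_le[of 1 M] by (auto simp: cycle_matching_def matching_def)
    then have "finite M" "card M = 0" using finite_subset[of M "{..<1}"] by (blast, linarith)
    then show "M \<in> {{}}" by simp
  qed (simp add: cycle_matching_def matching_def disjoint_family_on_def)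
  then show ?thesis using True by (simp add: matching_gf_def gamma_term_def monom_Suc one_pCons)
next
  case False
  define l where "l = m - 2"
  have l: "m = l + 2" using False assms by (simp add: l_def)
  have inj: "inj_on (\<lambda>M. insert (l + 1) (Suc ` M)) {M. path_matching l M}"
  proof (rule inj_onI)
    fix M N assume "M \<in> {M. path_matching l M}" "N \<in> {M. path_matching l M}"
      and eq: "insert (l + 1) (Suc ` M) = insert (l + 1) (Suc ` N)"
    then have "l + 1 \<notin> Suc ` M" "l + 1 \<notin> Suc ` N" by (auto simp: path_matching_iff)
    then have "Suc ` M = Suc ` N" using eq by (metis insert_ident)
    then show "M = N" by (simp add: inj_image_eq_iff)
  qed
  have term_eq: "gamma_term m (card (insert (l + 1) (Suc ` M))) = - [:0, 1:] * gamma_term l (card M)"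
    if "path_matching l M" for M
  proof -
    have "l + 1 \<notin> Suc ` M" using that by (auto simp: path_matching_iff)
    then have "card (insert (l + 1) (Suc ` M)) = Suc (card M)"
      using finite_path_matching[OF that] by (simp add: card_image)
    then show ?thesis
      using gamma_term_edge[OF card_path_matching_le[OF that]] l by simp
  qed
  have path: "{M. path_matching m M} = {M. cycle_matching (l + 2) M \<and> l + 1 \<notin> M}"
    unfolding l cycle_matchings_without_last ..
  have "{M. cycle_matching m M} =
      {M. cycle_matching (l + 2) M \<and> l + 1 \<in> M} \<union> {M. path_matching m M}"
    unfolding path by (auto simp: l)
  moreover have "(\<Sum>M \<in> {M. cycle_matching (l + 2) M \<and> l + 1 \<in> M} \<union> {M. path_matching m M}.
        gamma_term m (card M)) =
      (\<Sum>M | cycle_matching (l + 2) M \<and> l + 1 \<in> M. gamma_term m (card M)) +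
      (\<Sum>M | path_matching m M. gamma_term m (card M))"
    unfolding path using finite_cycle_matchings[of "l + 2"] by (intro sum.union_disjoint) auto
  ultimately have "matching_gf cycle_matching m =
      (\<Sum>M | cycle_matching (l + 2) M \<and> l + 1 \<in> M. gamma_term m (card M)) + matching_gf path_matching m"
    unfolding matching_gf_def by (simp only:)
  also have "(\<Sum>M | cycle_matching (l + 2) M \<and> l + 1 \<in> M. gamma_term m (card M)) =
      - [:0, 1:] * matching_gf path_matching l"
    unfolding cycle_matchings_with_last sum.reindex[OF inj] matching_gf_def sum_distrib_left
    by (intro sum.cong refl) (simp only: comp_def mem_Collect_eq term_eq)
  \<comment> \<open>Uses \<open>[l + 3] = [l + 2] + q^(l + 2)\<close> and
    \<open>[l + 2] = 1 + q [l + 1]\<close>.\<close>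
  also have "- [:0, 1:] * matching_gf path_matching l + matching_gf path_matching m = 1 + monom 1 m"
    unfolding matching_gf_path l add_2_eq_Suc' q_int_Suc'[of "Suc (Suc l)"] q_int_Suc[of "Suc l"]
    by simp
  finally show ?thesis .
qed

section \<open>Tuples of matchings\<close>

lemma list_all2_Cons_set:
  "{Ms. list_all2 P (m # ms) Ms} = (\<lambda>(M, Ms). M # Ms) ` ({M. P m M} \<times> {Ms. list_all2 P ms Ms})"
  by (auto simp: list_all2_Cons1 image_iff)

lemma finite_matching_tuples:
  assumes "\<And>m. finite {M. P m M}"
  shows "finite {Ms. list_all2 P ms Ms}"
  by (induction ms) (simp_all add: list_all2_Cons_set assms del: list_all2_Cons1)

lemma card_matching_tuple_le:
  fixes P :: "nat \<Rightarrow> 'a set \<Rightarrow> bool"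
  assumes "\<And>m M. P m M \<Longrightarrow> 2 * card M \<le> m" "list_all2 P ms Ms"
  shows "2 * sum_list (map card Ms) \<le> sum_list ms"
  using assms(2) by induction (use assms(1) in fastforce)+

text \<open>Weights multiply when vertex and edge counts add, so the sum over tuples
  factors.\<close>

lemma sum_matching_tuples:
  assumes "\<And>m. finite {M. P m M}" and le: "\<And>m M. P m M \<Longrightarrow> 2 * card M \<le> m"
  shows "(\<Sum>Ms | list_all2 P ms Ms. gamma_term (sum_list ms) (sum_list (map card Ms))) =
    prod_list (map (matching_gf P) ms)"
proof (induction ms)
  case Nil
  then show ?case by (simp add: gamma_term_def)
next
  case (Cons m ms)
  have inj: "inj_on (\<lambda>(M, Ms). M # Ms) X" for X :: "(nat set \<times> nat set list) set"
    by (auto simp: inj_on_def)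
  have "(\<Sum>Ms | list_all2 P (m # ms) Ms. gamma_term (sum_list (m # ms)) (sum_list (map card Ms))) =
      (\<Sum>(M, Ms)\<in>{M. P m M} \<times> {Ms. list_all2 P ms Ms}.
        gamma_term m (card M) * gamma_term (sum_list ms) (sum_list (map card Ms)))"
    unfolding list_all2_Cons_set sum.reindex[OF inj]
    by (intro sum.cong) (auto simp: gamma_term_mult le card_matching_tuple_le[OF le])
  then show ?case
    unfolding list.map prod_list.Cons Cons.IH[symmetric] matching_gf_def[of P m] sum_product
      sum.cartesian_product .
qed

text \<open>The list \<open>js\<close> is forced to be \<open>map card Ms\<close>, so the union over
  \<open>js\<close> becomes one condition on the total number of edges.\<close>

lemma matching_tuples_iff:
  "(\<exists>js. length js = length ms \<and> sum_list js = j \<and>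
      Ms \<in> listset (map2 (\<lambda>m j. {M. P m M \<and> card M = j}) ms js)) \<longleftrightarrow>
    list_all2 P ms Ms \<and> sum_list (map card Ms) = j"
proof -
  have *: "length js = length ms \<and> Ms \<in> listset (map2 (\<lambda>m j. {M. P m M \<and> card M = j}) ms js) \<longleftrightarrow>
      list_all2 P ms Ms \<and> js = map card Ms" for js
  proof (induction ms arbitrary: js Ms)
    case Nil
    then show ?case by auto
  next
    case (Cons m ms)
    show ?case
    proof (cases js)
      case Nil
      then show ?thesis by (auto simp: list_all2_Cons1)
    next
      case (Cons j js')
      then show ?thesis
        using Cons.IH[of js'] by (auto simp: list_all2_Cons1 set_Cons_def)
    qed
  qed
  show ?thesis
  proof (intro iffI; (elim exE)?)
    fix js
    assume "length js = length ms \<and> sum_list js = j \<and>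
      Ms \<in> listset (map2 (\<lambda>m j. {M. P m M \<and> card M = j}) ms js)"
    then show "list_all2 P ms Ms \<and> sum_list (map card Ms) = j" using *[of js] by simp
  next
    assume "list_all2 P ms Ms \<and> sum_list (map card Ms) = j"
    then show "\<exists>js. length js = length ms \<and> sum_list js = j \<and>
        Ms \<in> listset (map2 (\<lambda>m j. {M. P m M \<and> card M = j}) ms js)"
      using *[of "map card Ms"] by (intro exI[of _ "map card Ms"]) simp
  qed
qed

lemma path_matching_tuples_eq:
  "path_matching_tuples n j =
     {Ms \<in> {Ms. list_all2 path_matching [1..<n] Ms}. sum_list (map card Ms) = j}"
  unfolding mem_Collect_eq matching_tuples_iff[symmetric] path_matching_tuples_def
    path_matchings_def length_upt by blast

lemma cycle_matching_tuples_eq: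
  "cycle_matching_tuples n j =
     {Ms \<in> {Ms. list_all2 cycle_matching [1..<n+1] Ms}. sum_list (map card Ms) = j}"
  unfolding mem_Collect_eq matching_tuples_iff[symmetric] cycle_matching_tuples_def
    cycle_matchings_def length_upt diff_add_inverse2 by blast

text \<open>Identifies the total number of vertices with the palindromic degree; cycles use it at
  \<open>n + 1\<close>.\<close>

lemma sum_list_upt_choose: "sum_list [1..<n] = n choose 2"
  by (induction n) (auto simp: numeral_2_eq_2)

lemma prod_list_upt: "prod_list (map f [1..<Suc n]) = (\<Prod>m=1..n. f m :: int poly)"
  by (induction n) auto

text \<open>Paths with 1 to \<open>n - 1\<close> vertices give \<open>[2]\<close> to
  \<open>[n]\<close>, and \<open>[1] = 1\<close>.\<close>

lemma prod_list_path_gf: "prod_list (map (matching_gf path_matching) [1..<n]) = q_fact n"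
  by (induction n) (auto simp: q_fact_Suc matching_gf_path q_fact_def q_int_def Suc_le_eq)

section \<open>Lucanomials\<close>

definition partitions_in :: "nat \<Rightarrow> nat \<Rightarrow> nat list set" where
  "partitions_in k m = {lam. fits_in_rectangle lam k m}"

lemma finite_partitions_in: "finite (partitions_in k m)"
  by (rule finite_subset[OF _ finite_lists_length_eq[of "{..m}" k]])
    (auto simp: partitions_in_def fits_in_rectangle_def)

lemma partitions_in_0_left: "partitions_in 0 m = {[]}"
  by (auto simp: partitions_in_def fits_in_rectangle_def)

lemma partitions_in_0_right: "partitions_in k 0 = {replicate k 0}"
  by (auto simp: partitions_in_def fits_in_rectangle_def replicate_eqI sorted_wrt_iff_nth_less)

lemma partitions_in_Suc_Suc:
  "partitions_in (Suc k) (Suc m) = Cons (Suc m) ` partitions_in k (Suc m) \<union> partitions_in (Suc k) m"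
  (is "?L = ?R")
proof (intro subset_antisym subsetI)
  fix lam assume "lam \<in> ?L"
  then obtain a mu where "lam = a # mu" "length mu = k" "a \<le> Suc m" "\<forall>x\<in>set mu. x \<le> a"
      "sorted_wrt (\<ge>) mu"
    by (cases lam) (auto simp: partitions_in_def fits_in_rectangle_def)
  then show "lam \<in> ?R"
    by (cases "a = Suc m") (auto simp: partitions_in_def fits_in_rectangle_def)
qed (auto simp: partitions_in_def fits_in_rectangle_def le_SucI)

text \<open>A full row raises \<open>k\<close> and every count of large parts by one, so the
  differences stay.\<close>

lemma complement_partition_Cons:
  "complement_partition (Suc k) m (m # lam) = complement_partition k m lam"
proof -
  have "{s. s < Suc k \<and> (m # lam) ! s \<ge> m + 1 - r} =
      insert 0 (Suc ` {s. s < k \<and> lam ! s \<ge> m + 1 - r})" if "r \<ge> 1" for r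
  proof (rule set_eqI)
    fix s
    show "s \<in> {s. s < Suc k \<and> (m # lam) ! s \<ge> m + 1 - r} \<longleftrightarrow>
        s \<in> insert 0 (Suc ` {s. s < k \<and> lam ! s \<ge> m + 1 - r})"
      using that by (cases s) auto
  qed
  then have "card {s. s < Suc k \<and> (m # lam) ! s \<ge> m + 1 - r} =
      Suc (card {s. s < k \<and> lam ! s \<ge> m + 1 - r})" if "r \<ge> 1" for r
    using that by (simp add: card_insert_if card_image)
  then show ?thesis by (auto simp: complement_partition_def simp del: upt_Suc)
qed

text \<open>The rectangle gains a column that \<open>lam\<close> does not reach, so the complement
  gains a first part \<open>k\<close>.\<close>

lemma complement_partition_Suc:
  assumes "lam \<in> partitions_in k m"
  shows "complement_partition k (Suc m) lam = k # complement_partition k m lam"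
proof -
  have empty: "{s. s < k \<and> lam ! s \<ge> Suc m + 1 - 1} = {}"
    using assms by (auto simp: partitions_in_def fits_in_rectangle_def not_le less_Suc_eq_le)
  \<comment> \<open>Position \<open>Suc r\<close> for \<open>Suc m\<close> has the same threshold as
    position \<open>r\<close> for \<open>m\<close>.\<close>
  have upt: "[1..<Suc m + 1] = 1 # map Suc [1..<m + 1]"
    by (simp add: map_Suc_upt upt_conv_Cons del: upt_Suc)
  show ?thesis
    unfolding complement_partition_def upt list.map empty by (simp del: upt_Suc)
qed

text \<open>Makes the total number of vertices equal to the palindromic degree
  \<open>k * m\<close>.\<close>

lemma sum_list_complement:
  "lam \<in> partitions_in k m \<Longrightarrow> sum_list lam + sum_list (complement_partition k m lam) = k * m"
proof (induction "k + m" arbitrary: k m lam rule: less_induct)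
  case less
  show ?case
  proof (cases "k = 0 \<or> m = 0")
    case True
    then show ?thesis
      using less.prems
      by (auto simp: partitions_in_0_left partitions_in_0_right complement_partition_def
          sum_list_replicate sum_list_0)
  next
    case False
    then obtain k' m' where km: "k = Suc k'" "m = Suc m'" by (meson not0_implies_Suc)
    from less.prems consider mu where "lam = m # mu" "mu \<in> partitions_in k' m" | "lam \<in> partitions_in k m'"
      unfolding km partitions_in_Suc_Suc by blast
    then show ?thesis
    proof cases
      case 1
      then show ?thesis using less.hyps[of k' m mu] km(1) by (simp add: complement_partition_Cons)
    next
      case 2
      then show ?thesis using less.hyps[of k m' lam] km(2) by (simp add: complement_partition_Suc)
    qed
  qed
qed

section \<open>Lucanomial generating polynomials and q-binomial coefficients\<close>

definition lucanomial_gf :: "nat \<Rightarrow> nat \<Rightarrow> int poly" where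
  "lucanomial_gf k m = (\<Sum>lam\<in>partitions_in k m. prod_list (map (matching_gf path_matching) lam) *
     prod_list (map (matching_gf strict_path_matching) (complement_partition k m lam)))"

text \<open>A maximal first part is a path contributing \<open>[m + 2]\<close>; otherwise the
  complement has a first part \<open>k + 1\<close>, whose strict matchings contribute
  \<open>-q [k]\<close>.\<close>

lemma lucanomial_gf_Suc_Suc:
  "lucanomial_gf (Suc k) (Suc m) =
     q_int (m + 2) * lucanomial_gf k (Suc m) - [:0, 1:] * q_int k * lucanomial_gf (Suc k) m"
proof -
  have disj: "Cons (Suc m) ` partitions_in k (Suc m) \<inter> partitions_in (Suc k) m = {}"
    by (auto simp: partitions_in_def fits_in_rectangle_def)
  show ?thesis
    unfolding lucanomial_gf_def[of "Suc k" "Suc m"] partitions_in_Suc_Suc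
      sum.union_disjoint[OF finite_imageI[OF finite_partitions_in] finite_partitions_in disj]
    by (simp add: sum.reindex complement_partition_Cons complement_partition_Suc matching_gf_path
        matching_gf_strict_Suc lucanomial_gf_def sum_distrib_left sum_negf mult_ac
        del: mult_pCons_left mult_pCons_right)
qed

text \<open>The addition formula of the Lucas recurrence, from \<open>[k + 1] = 1 + q [k]\<close>
  and \<open>[m + 2] - [m + 1] = q^(m + 1)\<close>.\<close>

lemma q_int_addition: "q_int (m + 2) * q_int (Suc k) - [:0, 1:] * q_int k * q_int (Suc m) = q_int (k + m + 2)"
proof -
  have "q_int (m + 2) * q_int (Suc k) - [:0, 1:] * q_int k * q_int (Suc m) =
      q_int (m + 2) + [:0, 1:] * q_int k * (q_int (m + 2) - q_int (Suc m))"
    unfolding q_int_Suc[of k] by (simp only: algebra_simps mult_1_right)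
  also have "\<dots> = q_int (m + 2) + monom 1 (m + 2) * q_int k"
    by (simp add: q_int_Suc'[of "Suc m"] monom_Suc mult_ac)
  also have "\<dots> = q_int (k + m + 2)"
    using q_int_add[of "m + 2" k] by (simp add: add_ac)
  finally show ?thesis .
qed

lemma lucanomial_gf_mult: "lucanomial_gf k m * (q_fact k * q_fact m) = q_fact (k + m)"
proof (induction "k + m" arbitrary: k m rule: less_induct)
  case less
  show ?case
  proof (cases "k = 0 \<or> m = 0")
    case True
    \<comment> \<open>In a degenerate rectangle all parts are 0, so every factor is 1.\<close>
    have "complement_partition 0 m [] = replicate m 0" for m
      by (simp add: complement_partition_def map_replicate_const)
    moreover have "complement_partition k 0 lam = []" for k lam
      by (simp add: complement_partition_def)
    ultimately show ?thesis
      using True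
      by (auto simp: lucanomial_gf_def partitions_in_0_left partitions_in_0_right
          matching_gf_strict_0 matching_gf_path q_int_def q_fact_def)
  next
    case False
    then obtain k' m' where km: "k = Suc k'" "m = Suc m'" by (meson not0_implies_Suc)
    let ?N = "q_fact (k' + m' + 1)"
    have 1: "lucanomial_gf k' (Suc m') * (q_fact k' * q_fact (Suc m')) = ?N"
      and 2: "lucanomial_gf (Suc k') m' * (q_fact (Suc k') * q_fact m') = ?N"
      using less[of k' "Suc m'"] less[of "Suc k'" m'] km by simp_all
    \<comment> \<open>\<open>q_fact k\<close> gives up \<open>[k' + 1]\<close> in the first term and
      \<open>q_fact m\<close> gives up \<open>[m' + 1]\<close> in the second, so that each contains
      one induction hypothesis.\<close>
    have "lucanomial_gf k m * (q_fact k * q_fact m) =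
        q_int (m' + 2) * q_int (Suc k') * (lucanomial_gf k' (Suc m') * (q_fact k' * q_fact (Suc m'))) -
        [:0, 1:] * q_int k' * q_int (Suc m') * (lucanomial_gf (Suc k') m' * (q_fact (Suc k') * q_fact m'))"
      unfolding km lucanomial_gf_Suc_Suc left_diff_distrib q_fact_Suc by (simp only: mult_ac)
    also have "\<dots> = (q_int (m' + 2) * q_int (Suc k') - [:0, 1:] * q_int k' * q_int (Suc m')) * ?N"
      unfolding 1 2 left_diff_distrib ..
    also have "\<dots> = q_fact (k + m)"
      unfolding q_int_addition using q_fact_Suc[of "k' + m' + 1"] by (simp add: km mult_ac)
    finally show ?thesis .
  qed
qed

lemma lucanomial_gf_eq_q_binomial:
  assumes "k \<le> n"
  shows "lucanomial_gf k (n - k) = q_binomial n k"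
  using q_binomial_mult[OF assms] lucanomial_gf_mult[of k "n - k"] assms
    q_fact_nonzero[of k] q_fact_nonzero[of "n - k"]
  by (metis le_add_diff_inverse mult_cancel_right no_zero_divisors)

section \<open>The sum over all Lucanomial matchings\<close>

abbreviation "path_tuples lam \<equiv> {Ms. list_all2 path_matching lam Ms}"
abbreviation "strict_tuples mu \<equiv> {Ms. list_all2 strict_path_matching mu Ms}"

text \<open>The number of edges is left free, to be summed over; the sum is dependent because both
  tuples are shaped by \<open>lam\<close>.\<close>

definition lucanomial_triples :: "nat \<Rightarrow> nat \<Rightarrow> (nat list \<times> nat set list \<times> nat set list) set" where
  "lucanomial_triples k m =
     (SIGMA lam:partitions_in k m. path_tuples lam \<times> strict_tuples (complement_partition k m lam))"

definition edges :: "nat list \<times> nat set list \<times> nat set list \<Rightarrow> nat" where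
  "edges = (\<lambda>(lam, Ms, Ms'). sum_list (map card (Ms @ Ms')))"

lemma card_strict_path_matching_le: "strict_path_matching m M \<Longrightarrow> 2 * card M \<le> m"
  by (simp add: strict_path_matching_def card_path_matching_le)

lemma finite_lucanomial_triples: "finite (lucanomial_triples k m)"
  unfolding lucanomial_triples_def
  by (intro finite_SigmaI finite_partitions_in finite_cartesian_product finite_matching_tuples
      finite_path_matchings finite_strict_path_matchings)

lemma path_tuple_le:
  "list_all2 path_matching ms Ms \<Longrightarrow> 2 * sum_list (map card Ms) \<le> sum_list ms"
  by (rule card_matching_tuple_le[OF card_path_matching_le])

lemma strict_tuple_le:
  "list_all2 strict_path_matching ms Ms \<Longrightarrow> 2 * sum_list (map card Ms) \<le> sum_list ms"
  by (rule card_matching_tuple_le[OF card_strict_path_matching_le])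

lemma edges_le:
  assumes "x \<in> lucanomial_triples k m"
  shows "2 * edges x \<le> k * m"
proof -
  obtain lam Ms Ms' where x: "x = (lam, Ms, Ms')" by (cases x)
  then have "lam \<in> partitions_in k m" "list_all2 path_matching lam Ms"
      "list_all2 strict_path_matching (complement_partition k m lam) Ms'"
    using assms by (simp_all add: lucanomial_triples_def)
  then show ?thesis
    using path_tuple_le[of lam Ms] strict_tuple_le[of "complement_partition k m lam" Ms']
      sum_list_complement[of lam k m]
    by (simp add: x edges_def)
qed

text \<open>Since \<open>lam\<close> and its complement fill the rectangle, the weight for
  \<open>k * m\<close> splits into one for paths and one for strict paths.\<close>

lemma sum_lucanomial_triples:
  "(\<Sum>x\<in>lucanomial_triples k m. gamma_term (k * m) (edges x)) = lucanomial_gf k m"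
proof -
  have "(\<Sum>x\<in>lucanomial_triples k m. gamma_term (k * m) (edges x)) =
      (\<Sum>lam\<in>partitions_in k m. \<Sum>x\<in>path_tuples lam \<times> strict_tuples (complement_partition k m lam).
         gamma_term (k * m) (edges (lam, x)))"
    unfolding lucanomial_triples_def
    by (subst sum.Sigma) (auto simp: case_prod_beta intro!: finite_partitions_in finite_matching_tuples
      finite_path_matchings finite_strict_path_matchings)
  also have "\<dots> = (\<Sum>lam\<in>partitions_in k m.
       \<Sum>(Ms, Ms')\<in>path_tuples lam \<times> strict_tuples (complement_partition k m lam).
         gamma_term (sum_list lam) (sum_list (map card Ms)) *
         gamma_term (sum_list (complement_partition k m lam)) (sum_list (map card Ms')))"
    by (intro sum.cong refl)
      (auto simp: edges_def sum_list_complement[symmetric] gamma_term_mult path_tuple_le strict_tuple_le)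
  also have "\<dots> = lucanomial_gf k m"
    unfolding lucanomial_gf_def
    by (simp add: sum.cartesian_product[symmetric] sum_product[symmetric] sum_matching_tuples
        finite_path_matchings finite_strict_path_matchings card_path_matching_le
        card_strict_path_matching_le)
  finally show ?thesis .
qed

lemma lucanomial_matchings_eq:
  "lucanomial_matchings n k j = {x \<in> lucanomial_triples k (n - k). edges x = j}"
  by (auto simp: lucanomial_matchings_def lucanomial_triples_def partitions_in_def edges_def)

theorem theorem4p1:
  fixes n i k :: nat
  assumes "n \<ge> 1"
  shows "(g_vector (n choose 2) (q_fact n) i =
           (\<Sum>j. (-1) ^ j * int (card (path_matching_tuples n j \<times> ballot_paths (n choose 2) i j))))
    \<and> (g_vector ((n + 1) choose 2) (\<Prod>m=1..n. 1 + monom 1 m) i =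
           (\<Sum>j. (-1) ^ j * int (card (cycle_matching_tuples n j \<times> ballot_paths ((n + 1) choose 2) i j))))
    \<and> (k \<le> n \<longrightarrow> g_vector (k * (n - k)) (q_binomial n k) i =
           (\<Sum>j. (-1) ^ j * int (card (lucanomial_matchings n k j \<times> ballot_paths (k * (n - k)) i j))))"
proof (intro conjI impI)
  show "g_vector (n choose 2) (q_fact n) i =
      (\<Sum>j. (-1) ^ j * int (card (path_matching_tuples n j \<times> ballot_paths (n choose 2) i j)))"
  proof (rule g_vector_sum_gamma_term[OF palindromic_q_fact _ _ _ path_matching_tuples_eq])
    show "q_fact n = (\<Sum>Ms | list_all2 path_matching [1..<n] Ms.
        gamma_term (n choose 2) (sum_list (map card Ms)))"
      unfolding prod_list_path_gf[symmetric] sum_list_upt_choose[symmetric]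
      by (rule sum_matching_tuples[symmetric]) (simp_all add: finite_path_matchings card_path_matching_le)
    show "2 * sum_list (map card Ms) \<le> n choose 2"
      if "Ms \<in> {Ms. list_all2 path_matching [1..<n] Ms}" for Ms
      using path_tuple_le[of "[1..<n]" Ms] that unfolding sum_list_upt_choose by simp
  qed (intro finite_matching_tuples finite_path_matchings)
  show "g_vector ((n + 1) choose 2) (\<Prod>m=1..n. 1 + monom 1 m) i =
      (\<Sum>j. (-1) ^ j * int (card (cycle_matching_tuples n j \<times> ballot_paths ((n + 1) choose 2) i j)))"
  proof (rule g_vector_sum_gamma_term[OF palindromic_prod _ _ _ cycle_matching_tuples_eq])
    have "prod_list (map (matching_gf cycle_matching) [1..<n + 1]) = (\<Prod>m=1..n. 1 + monom 1 m)"
      unfolding Suc_eq_plus1[symmetric] prod_list_upt by (rule prod.cong) (auto simp: matching_gf_cycle)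
    then show "(\<Prod>m=1..n. 1 + monom 1 m) = (\<Sum>Ms | list_all2 cycle_matching [1..<n + 1] Ms.
        gamma_term ((n + 1) choose 2) (sum_list (map card Ms)))"
      unfolding sum_list_upt_choose[symmetric]
      by (subst sum_matching_tuples) (simp_all add: finite_cycle_matchings card_cycle_matching_le)
    show "2 * sum_list (map card Ms) \<le> (n + 1) choose 2"
      if "Ms \<in> {Ms. list_all2 cycle_matching [1..<n + 1] Ms}" for Ms
      using that unfolding sum_list_upt_choose[symmetric]
      by (intro card_matching_tuple_le[of cycle_matching]) (simp_all add: card_cycle_matching_le)
  qed (intro finite_matching_tuples finite_cycle_matchings)
  show "g_vector (k * (n - k)) (q_binomial n k) i =
      (\<Sum>j. (-1) ^ j * int (card (lucanomial_matchings n k j \<times> ballot_paths (k * (n - k)) i j)))"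
    if "k \<le> n"
    by (rule g_vector_sum_gamma_term[OF palindromic_q_binomial[OF that] _ _ _ lucanomial_matchings_eq])
      (simp_all add: sum_lucanomial_triples lucanomial_gf_eq_q_binomial that finite_lucanomial_triples edges_le)
qed

end
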